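(* Let $K$ be a field, let $k$ be an odd positive integer, and let $$f=\sum_{1\le i,j\le k}x_i\,y_j\,z_{[j-i]_k}\,w_{[i+j]_k}\in K[x_1,\dots,x_k,y_1,\dots,y_k,z_1,\dots,z_k,w_1,\dots,w_k].$$ Then $f$ is a balanced neighborly polynomial of type $(k,k,k,k)$.
   Context: For an integer $i$, $[i]_k\in\{1,2,\dots,k\}$ denotes the number with $[i]_k\equiv i \pmod k$. The ring $R=K[x_1,\dots,x_k,y_1,\dots,y_k,z_1,\dots,z_k,w_1,\dots,w_k]$ is $\mathbb{Z}^4$-graded by $\deg(x_i)=\mathfrak{e}_1=(1,0,0,0)$, $\deg(y_i)=\mathfrak{e}_2=(0,1,0,0)$, $\deg(z_i)=\mathfrak{e}_3=(0,0,1,0)$, $\deg(w_i)=\mathfrak{e}_4=(0,0,0,1)$. A polynomial $f\in R$ is balanced if it is homogeneous for this grading of degree $(1,1,1,1)$. For $S\subseteq\{1,2,3,4\}$ put $\mathfrak{e}_S=\sum_{i\in S}\mathfrak{e}_i$, let $R_{\mathfrak{e}_S}$ be the graded component of degree $\mathfrak{e}_S$, and for balanced $f$ set $H(f,S)=\dim_K\{g(\partial)f\mid g\in R_{\mathfrak{e}_S}\}$, where $g(\partial)$ is the differential operator obtained from $g$ by replacing each variable by the partial derivative with respect to that variable. A balanced polynomial $f\in R$ is a balanced neighborly polynomial of type $(k,k,k,k)$ if $H(f,S)=k^{|S|}$ for every $S\subseteq\{1,2,3,4\}$ with $|S|\le 2$. *)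

theory Defs
  imports
    Complex_Main
    "HOL-Library.Poly_Mapping"
    "HOL-Library.Product_Plus"
    "HOL-Number_Theory.Cong"
begin

text \<open>
  Polynomials are finitely supported maps from exponent vectors to coefficients. The variables
  below carry arbitrary natural indices; the ring
  \<open>R = K[x\<^sub>1,\<dots>,x\<^sub>k,y\<^sub>1,\<dots>,y\<^sub>k,z\<^sub>1,\<dots>,z\<^sub>k,w\<^sub>1,\<dots>,w\<^sub>k]\<close>
  is cut out by restricting the indices to \<open>{1..k}\<close>.
\<close>

datatype var = X nat | Y nat | Z nat | W nat

type_synonym monom = "var \<Rightarrow>\<^sub>0 nat"

type_synonym 'a mpoly = "monom \<Rightarrow>\<^sub>0 'a"

definition vars :: "nat \<Rightarrow> var set"
  where "vars k = X ` {1..k} \<union> Y ` {1..k} \<union> Z ` {1..k} \<union> W ` {1..k}"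

definition Var :: "var \<Rightarrow> 'a::field mpoly"
  where "Var v = Poly_Mapping.single (Poly_Mapping.single v 1) 1"

definition R :: "nat \<Rightarrow> 'a::field mpoly set"
  where "R k = {p. \<forall>m\<in>Poly_Mapping.keys p. Poly_Mapping.keys m \<subseteq> vars k}"

definition scale :: "'a::field \<Rightarrow> 'a mpoly \<Rightarrow> 'a mpoly"
  where "scale c p = Poly_Mapping.single 0 c * p"

interpretation mpoly: vector_space "scale :: 'a::field \<Rightarrow> 'a mpoly \<Rightarrow> 'a mpoly"
proof
  show "scale a (x + y) = scale a x + scale a y" for a :: 'a and x y
    by (simp add: scale_def distrib_left)
  show "scale (a + b) x = scale a x + scale b x" for a b :: 'a and x
    by (simp add: scale_def single_add distrib_right)
  show "scale a (scale b x) = scale (a * b) x" for a b :: 'a and x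
    by (simp add: scale_def mult_single flip: mult.assoc)
  show "scale 1 x = x" for x :: "'a mpoly"
    by (simp add: scale_def)
qed

type_synonym deg4 = "int \<times> int \<times> int \<times> int"

definition e :: "nat \<Rightarrow> deg4"
  where "e i = (of_bool (i = 1), of_bool (i = 2), of_bool (i = 3), of_bool (i = 4))"

definition eS :: "nat set \<Rightarrow> deg4"
  where "eS S = (\<Sum>i\<in>S. e i)"

fun var_deg :: "var \<Rightarrow> deg4" where
  "var_deg (X i) = e 1"
| "var_deg (Y i) = e 2"
| "var_deg (Z i) = e 3"
| "var_deg (W i) = e 4"

text \<open>The inner sum is the multiple \<open>m(v) \<sqdot> deg v\<close>.\<close>

definition monom_deg :: "monom \<Rightarrow> deg4"
  where "monom_deg m = (\<Sum>v\<in>Poly_Mapping.keys m. \<Sum>_<Poly_Mapping.lookup m v. var_deg v)"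

definition graded_component :: "nat \<Rightarrow> deg4 \<Rightarrow> 'a::field mpoly set"
  where "graded_component k d = {p \<in> R k. \<forall>m\<in>Poly_Mapping.keys p. monom_deg m = d}"

text \<open>
  The formal partial derivative. Exponent subtraction is truncated, but a monomial not involving
  \<open>v\<close> gets the coefficient \<open>0\<close>.
\<close>

definition partial :: "var \<Rightarrow> 'a::field mpoly \<Rightarrow> 'a mpoly"
  where "partial v p = (\<Sum>m\<in>Poly_Mapping.keys p.
    Poly_Mapping.single (m - Poly_Mapping.single v 1)
      (of_nat (Poly_Mapping.lookup m v) * Poly_Mapping.lookup p m))"

lemma lookup_partial:
  "Poly_Mapping.lookup (partial v p) m =
     of_nat (Poly_Mapping.lookup m v + 1) * Poly_Mapping.lookup p (m + Poly_Mapping.single v 1)"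
    (is "_ = ?r")
proof -
  let ?s = "Poly_Mapping.single v (1::nat)"
  have eq: "(of_nat (Poly_Mapping.lookup n v) * Poly_Mapping.lookup p n when n - ?s = m)
      = (if n = m + ?s then ?r else 0)" for n
  proof (cases "n = m + ?s")
    case True
    then show ?thesis by (simp add: lookup_add)
  next
    case False
    have "Poly_Mapping.lookup n v = 0" if "n - ?s = m"
    proof (rule ccontr)
      assume pos: "Poly_Mapping.lookup n v \<noteq> 0"
      have "n = m + ?s"
        by (rule poly_mapping_eqI)
          (use pos that in \<open>auto simp: lookup_add lookup_minus lookup_single when_def\<close>)
      with False show False by simp
    qed
    with False show ?thesis by (auto simp: when_def)
  qed
  have "Poly_Mapping.lookup (partial v p) m =
      (\<Sum>n\<in>Poly_Mapping.keys p. if n = m + ?s then ?r else 0)"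
    unfolding partial_def by (simp only: lookup_sum lookup_single eq)
  also have "\<dots> = ?r"
    by (auto simp: sum.delta in_keys_iff)
  finally show ?thesis .
qed

lemma partial_commute: "partial v (partial w p) = partial w (partial v p)"
proof (rule poly_mapping_eqI)
  fix m
  show "Poly_Mapping.lookup (partial v (partial w p)) m =
      Poly_Mapping.lookup (partial w (partial v p)) m"
    by (cases "v = w")
      (auto simp: lookup_partial lookup_add lookup_single when_def ac_simps)
qed

text \<open>
  The composite of the \<open>m(v)\<close>-fold partial derivatives over all variables \<open>v\<close> of \<open>m\<close>; the order
  is immaterial, so that \<^const>\<open>Finite_Set.fold\<close> is meaningful here.
\<close>

definition monom_op :: "monom \<Rightarrow> 'a::field mpoly \<Rightarrow> 'a mpoly"
  where "monom_op m p =
    Finite_Set.fold (\<lambda>v. partial v ^^ Poly_Mapping.lookup m v) p (Poly_Mapping.keys m)"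

lemma comp_fun_commute_partial_pow: "comp_fun_commute (\<lambda>v. (partial v :: 'a::field mpoly \<Rightarrow> 'a mpoly) ^^ n v)"
proof
  have 1: "partial v ((partial w ^^ i) p) = (partial w ^^ i) (partial v p)"
    for v w i and p :: "'a mpoly"
    by (induction i) (simp_all add: partial_commute[of v w])
  have 2: "(partial v ^^ j) ((partial w ^^ i) p) = (partial w ^^ i) ((partial v ^^ j) p)"
    for v w i j and p :: "'a mpoly"
    by (induction j) (simp_all add: 1)
  show "((partial y :: 'a mpoly \<Rightarrow> 'a mpoly) ^^ n y) \<circ> (partial x ^^ n x) = (partial x ^^ n x) \<circ> (partial y ^^ n y)" for x y
    by (rule ext) (unfold o_apply, rule 2)
qed

text \<open>The differential operator \<open>g(\<partial>)\<close>.\<close>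

definition diff_op :: "'a::field mpoly \<Rightarrow> 'a mpoly \<Rightarrow> 'a mpoly"
  where "diff_op g p =
    (\<Sum>m\<in>Poly_Mapping.keys g. scale (Poly_Mapping.lookup g m) (monom_op m p))"

definition balanced :: "nat \<Rightarrow> 'a::field mpoly \<Rightarrow> bool"
  where "balanced k f \<longleftrightarrow> f \<in> graded_component k (1, 1, 1, 1)"

definition H :: "nat \<Rightarrow> 'a::field mpoly \<Rightarrow> nat set \<Rightarrow> nat"
  where "H k f S = mpoly.dim {diff_op g f | g. g \<in> graded_component k (eS S)}"

text \<open>Neighborliness of type \<open>(k,k,k,k)\<close>.\<close>

definition balanced_neighborly :: "nat \<Rightarrow> 'a::field mpoly \<Rightarrow> bool"
  where "balanced_neighborly k f \<longleftrightarrow>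
    balanced k f \<and> (\<forall>S\<subseteq>{1, 2, 3, 4}. card S \<le> 2 \<longrightarrow> H k f S = k ^ card S)"

text \<open>\<open>[i]\<^sub>k\<close>, the representative of \<open>i\<close> modulo \<open>k\<close> in \<open>{1,\<dots>,k}\<close>.\<close>

definition repr_mod :: "nat \<Rightarrow> int \<Rightarrow> nat"
  where "repr_mod k i = (THE r. r \<in> {1..k} \<and> [int r = i] (mod int k))"

lemma repr_mod_eq:
  assumes "k > 0"
  shows "repr_mod k i = nat ((i - 1) mod int k) + 1"
  unfolding repr_mod_def
proof (rule the_equality)
  let ?r = "nat ((i - 1) mod int k) + 1"
  have r: "int ?r = (i - 1) mod int k + 1"
    using assms by simp
  have "int ?r \<le> int k"
    unfolding r using pos_mod_bound[of "int k" "i - 1"] assms by linarith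
  then have "?r \<in> {1..k}"
    unfolding of_nat_le_iff by simp
  moreover have "[int ?r = i] (mod int k)"
    unfolding r cong_def by (simp add: mod_add_left_eq)
  ultimately show *: "?r \<in> {1..k} \<and> [int ?r = i] (mod int k)" ..
  fix s assume s: "s \<in> {1..k} \<and> [int s = i] (mod int k)"
  then have "[int s - 1 = i - 1] (mod int k)"
    by (simp add: cong_diff)
  then have "(int s - 1) mod int k = (i - 1) mod int k"
    by (simp add: cong_def)
  moreover have "(int s - 1) mod int k = int s - 1"
    using s by (intro mod_pos_pos_trivial) auto
  ultimately show "s = ?r" using r by linarith
qed

end

theory Submission
  imports Defs "HOL-Library.FuncSet"
begin

text \<open>
  The monomials of \<open>f\<close> are the points \<open>(i, j, [j - i]\<^sub>k, [i + j]\<^sub>k)\<close> of the grid \<open>{1..k}\<^sup>4\<close>.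
  As \<open>k\<close> is odd, any two of the four coordinates determine the point and can be prescribed
  arbitrarily. Let \<open>|S| \<le> 2\<close>. Every monomial \<open>m\<close> of degree \<open>eS S\<close> divides some monomial \<open>m n\<close>
  of \<open>f\<close>, and as \<open>n\<close> involves at least two coordinates, \<open>m n\<close> is the only monomial of \<open>f\<close> that
  \<open>n\<close> divides. So \<open>n\<close> occurs in \<open>m(\<partial>)f\<close> with coefficient \<open>1\<close> and in no other
  \<open>m'(\<partial>)f\<close>, and the \<open>k\<^bsup>|S|\<^esup>\<close> derivatives are linearly independent.
\<close>

section \<open>Monomials of squarefree degree\<close>

fun kind :: "var \<Rightarrow> nat" where
  "kind (X i) = 1"
| "kind (Y i) = 2"
| "kind (Z i) = 3"
| "kind (W i) = 4"

fun idx :: "var \<Rightarrow> nat" where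
  "idx (X i) = i"
| "idx (Y i) = i"
| "idx (Z i) = i"
| "idx (W i) = i"

text \<open>Coordinates \<open>kind\<close> and \<open>idx\<close> on variables let the four
  families be treated uniformly. Numbers outside \<open>kinds\<close> fall through to
  \<open>W\<close>, hence the hypotheses \<open>s \<in> kinds\<close> below.\<close>

definition mkvar :: "nat \<Rightarrow> nat \<Rightarrow> var" where
  "mkvar s i = (if s = 1 then X i else if s = 2 then Y i else if s = 3 then Z i else W i)"

definition kinds :: "nat set" where "kinds = {1, 2, 3, 4}"

lemma finite_kinds [simp]: "finite kinds"
  by (simp add: kinds_def)

lemma card_kinds [simp]: "card kinds = 4"
  by (simp add: kinds_def)

lemma kind_in_kinds: "kind v \<in> kinds"
  by (cases v) (auto simp: kinds_def)

lemma kind_mkvar: "s \<in> kinds \<Longrightarrow> kind (mkvar s i) = s"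
  by (auto simp: mkvar_def kinds_def)

lemma idx_mkvar: "idx (mkvar s i) = i"
  by (auto simp: mkvar_def)

lemma mkvar_kind_idx: "mkvar (kind v) (idx v) = v"
  by (cases v) (auto simp: mkvar_def)

lemma mkvar_eq_iff: "s \<in> kinds \<Longrightarrow> mkvar s i = v \<longleftrightarrow> kind v = s \<and> idx v = i"
  using kind_mkvar idx_mkvar mkvar_kind_idx by metis

lemma vars_eq: "vars k = {v. idx v \<in> {1..k}}"
proof (rule set_eqI)
  show "v \<in> vars k \<longleftrightarrow> v \<in> {v. idx v \<in> {1..k}}" for v
    by (cases v) (auto simp: vars_def)
qed

text \<open>For \<open>S \<subseteq> kinds\<close> this is the squarefree monomial of a point
  \<open>c\<close> of the grid over \<open>S\<close>; values of \<open>c\<close> outside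
  \<open>S\<close> do not matter.\<close>

definition mon :: "nat set \<Rightarrow> (nat \<Rightarrow> nat) \<Rightarrow> monom" where
  "mon S c = (\<Sum>s\<in>S. Poly_Mapping.single (mkvar s (c s)) 1)"

lemma lookup_mon:
  assumes "S \<subseteq> kinds"
  shows "Poly_Mapping.lookup (mon S c) v = of_bool (kind v \<in> S \<and> c (kind v) = idx v)"
proof -
  have fin: "finite S" using assms by (rule finite_subset) simp
  have "Poly_Mapping.lookup (mon S c) v =
      (\<Sum>s\<in>S. if s = kind v then of_bool (c (kind v) = idx v) else 0)"
    unfolding mon_def lookup_sum lookup_single
  proof (rule sum.cong[OF refl])
    fix s assume "s \<in> S"
    with assms have "s \<in> kinds" by blast
    then show "(1 when mkvar s (c s) = v) = (if s = kind v then of_bool (c (kind v) = idx v) else 0)"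
      by (auto simp: mkvar_eq_iff when_def)
  qed
  then show ?thesis using fin by (simp add: sum.delta)
qed

lemma keys_mon:
  assumes "S \<subseteq> kinds"
  shows "Poly_Mapping.keys (mon S c) = (\<lambda>s. mkvar s (c s)) ` S"
proof (rule set_eqI)
  fix v
  have "v \<in> (\<lambda>s. mkvar s (c s)) ` S \<longleftrightarrow> (\<exists>s\<in>S. mkvar s (c s) = v)" by auto
  also have "\<dots> \<longleftrightarrow> (\<exists>s\<in>S. kind v = s \<and> idx v = c s)"
    using assms mkvar_eq_iff by blast
  finally show "v \<in> Poly_Mapping.keys (mon S c) \<longleftrightarrow> v \<in> (\<lambda>s. mkvar s (c s)) ` S"
    by (auto simp: in_keys_iff lookup_mon[OF assms])
qed

lemma inj_on_mkvar: "S \<subseteq> kinds \<Longrightarrow> inj_on (\<lambda>s. mkvar s (c s)) S"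
  by (rule inj_onI) (metis kind_mkvar subsetD)

lemma mon_eq_iff:
  assumes "S \<subseteq> kinds"
  shows "mon S c = mon S d \<longleftrightarrow> (\<forall>s\<in>S. c s = d s)"
proof
  assume eq: "mon S c = mon S d"
  show "\<forall>s\<in>S. c s = d s"
  proof
    fix s assume s: "s \<in> S"
    then have "kind (mkvar s (c s)) = s" using assms kind_mkvar by blast
    then have "Poly_Mapping.lookup (mon S c) (mkvar s (c s)) = 1"
      using s by (simp add: lookup_mon[OF assms] idx_mkvar)
    with eq have "Poly_Mapping.lookup (mon S d) (mkvar s (c s)) = 1" by simp
    then show "c s = d s"
      using \<open>kind (mkvar s (c s)) = s\<close>
      by (simp add: lookup_mon[OF assms] idx_mkvar of_bool_def split: if_splits)
  qed
qed (simp add: mon_def)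

text \<open>Together with \<open>mon_eq_iff\<close>, this splits an equation between a monomial of
  \<open>f\<close> and such a product into separate conditions on \<open>S\<close> and on its
  complement.\<close>

lemma mon_union:
  assumes "S \<subseteq> kinds"
  shows "mon (kinds - S) c + mon S d = mon kinds (\<lambda>s. if s \<in> S then d s else c s)"
  by (rule poly_mapping_eqI)
    (use kind_in_kinds in \<open>auto simp: lookup_add lookup_mon[OF assms] lookup_mon\<close>)

section \<open>Degrees\<close>

definition deg_part :: "nat \<Rightarrow> deg4 \<Rightarrow> int" where
  "deg_part s d = (case d of (a, b, c, d) \<Rightarrow>
    if s = 1 then a else if s = 2 then b else if s = 3 then c else d)"

lemma deg_part_add: "deg_part s (d + d') = deg_part s d + deg_part s d'"
  by (cases d; cases d') (simp add: deg_part_def)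

lemma deg_part_sum: "deg_part s (sum g A) = (\<Sum>x\<in>A. deg_part s (g x))"
proof (induction A rule: infinite_finite_induct)
qed (simp_all add: deg_part_add, simp_all add: deg_part_def zero_prod_def)

lemma deg_part_eqI: "(\<And>s. s \<in> kinds \<Longrightarrow> deg_part s d = deg_part s d') \<Longrightarrow> d = d'"
  by (cases d; cases d') (force simp: deg_part_def kinds_def)

lemma deg_part_e: "s \<in> kinds \<Longrightarrow> deg_part s (e t) = of_bool (s = t)"
  by (auto simp: deg_part_def e_def kinds_def)

lemma deg_part_var_deg: "s \<in> kinds \<Longrightarrow> deg_part s (var_deg v) = of_bool (kind v = s)"
  by (cases v) (auto simp: deg_part_e)

lemma deg_part_monom_deg:
  assumes "s \<in> kinds"
  shows "deg_part s (monom_deg m) =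
    int (\<Sum>v\<in>{v \<in> Poly_Mapping.keys m. kind v = s}. Poly_Mapping.lookup m v)"
  by (simp add: monom_deg_def deg_part_sum deg_part_var_deg[OF assms] Int_def)

lemma deg_part_eS:
  assumes "s \<in> kinds" "S \<subseteq> kinds"
  shows "deg_part s (eS S) = of_bool (s \<in> S)"
proof -
  have "finite S" using assms(2) by (rule finite_subset) simp
  then show ?thesis
    by (simp add: eS_def deg_part_sum deg_part_e[OF assms(1)] sum.delta' of_bool_def)
qed

lemma monom_deg_mon:
  assumes "S \<subseteq> kinds"
  shows "monom_deg (mon S c) = eS S"
proof (rule deg_part_eqI)
  fix s assume s: "s \<in> kinds"
  have "{v \<in> Poly_Mapping.keys (mon S c). kind v = s} = (if s \<in> S then {mkvar s (c s)} else {})"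
    using assms by (auto simp: keys_mon[OF assms] kind_mkvar subset_iff)
  moreover have "Poly_Mapping.lookup (mon S c) (mkvar s (c s)) = of_bool (s \<in> S)"
    using s by (simp only: lookup_mon[OF assms] kind_mkvar idx_mkvar) simp
  ultimately show "deg_part s (monom_deg (mon S c)) = deg_part s (eS S)"
    unfolding deg_part_monom_deg[OF s] deg_part_eS[OF s assms] by simp
qed

text \<open>Each entry of \<open>eS S\<close> is 0 or 1, and naturals with sum 1 have exactly one
  nonzero term, equal to 1. So such a monomial has one variable of each kind in \<open>S\<close> and
  no others.\<close>

lemma monom_deg_eS_iff:
  assumes "S \<subseteq> kinds"
  shows "Poly_Mapping.keys m \<subseteq> vars k \<and> monom_deg m = eS S \<longleftrightarrow> m \<in> mon S ` (S \<rightarrow>\<^sub>E {1..k})"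
proof
  assume "m \<in> mon S ` (S \<rightarrow>\<^sub>E {1..k})"
  then show "Poly_Mapping.keys m \<subseteq> vars k \<and> monom_deg m = eS S"
    using assms by (auto simp: monom_deg_mon keys_mon vars_eq idx_mkvar PiE_iff)
next
  assume m: "Poly_Mapping.keys m \<subseteq> vars k \<and> monom_deg m = eS S"
  have N: "(\<Sum>v\<in>{v \<in> Poly_Mapping.keys m. kind v = s}. Poly_Mapping.lookup m v) = of_bool (s \<in> S)"
    if "s \<in> kinds" for s
    using deg_part_monom_deg[OF that, of m] deg_part_eS[OF that assms] m
    by (metis of_nat_eq_iff of_nat_of_bool)
  have out: "Poly_Mapping.lookup m v = 0" if "kind v \<notin> S" for v
    using N[OF kind_in_kinds[of v]] that by (auto simp: in_keys_iff)
  have "\<exists>v. kind v = s \<and> Poly_Mapping.lookup m v = 1 \<and>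
      (\<forall>w. kind w = s \<longrightarrow> w \<noteq> v \<longrightarrow> Poly_Mapping.lookup m w = 0)" if "s \<in> S" for s
  proof -
    have "s \<in> kinds" using that assms by blast
    then have "(\<Sum>v\<in>{v \<in> Poly_Mapping.keys m. kind v = s}. Poly_Mapping.lookup m v) = Suc 0"
      using N that by simp
    then show ?thesis
      by (subst (asm) sum_eq_Suc0_iff) (auto simp: in_keys_iff)
  qed
  then obtain h where h: "\<And>s. s \<in> S \<Longrightarrow> kind (h s) = s \<and> Poly_Mapping.lookup m (h s) = 1 \<and>
      (\<forall>w. kind w = s \<longrightarrow> w \<noteq> h s \<longrightarrow> Poly_Mapping.lookup m w = 0)"
    by metis
  \<comment> \<open>Restricting makes \<open>c\<close> extensional, as membership in
    \<open>\<rightarrow>\<^sub>E\<close> demands.\<close>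
  define c where "c = restrict (\<lambda>s. idx (h s)) S"
  have "m = mon S c"
  proof (rule poly_mapping_eqI)
    fix v
    show "Poly_Mapping.lookup m v = Poly_Mapping.lookup (mon S c) v"
    proof (cases "kind v \<in> S")
      case True
      have "idx (h (kind v)) = idx v \<longleftrightarrow> h (kind v) = v"
        using h[OF True] mkvar_kind_idx by metis
      then show ?thesis
        using h[OF True] True by (auto simp: lookup_mon[OF assms] c_def)
    qed (simp add: lookup_mon[OF assms] out)
  qed
  moreover have "c \<in> S \<rightarrow>\<^sub>E {1..k}"
  proof (rule PiE_I)
    fix s assume s: "s \<in> S"
    then have "h s \<in> Poly_Mapping.keys m" using h by (simp add: in_keys_iff)
    then show "c s \<in> {1..k}" using m s by (auto simp: vars_eq c_def)
  qed (simp add: c_def)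
  ultimately show "m \<in> mon S ` (S \<rightarrow>\<^sub>E {1..k})" by blast
qed

lemma graded_component_eS:
  assumes "S \<subseteq> kinds"
  shows "graded_component k (eS S) = {p. Poly_Mapping.keys p \<subseteq> mon S ` (S \<rightarrow>\<^sub>E {1..k})}"
  unfolding graded_component_def R_def using monom_deg_eS_iff[OF assms, of _ k] by blast

section \<open>Derivatives\<close>

text \<open>Each derivative shifts the exponent of its own variable by one and contributes one
  factor; since the variables in \<open>A\<close> are distinct, these factors do not
  interact.\<close>

lemma lookup_fold_partial:
  fixes p :: "'a::field mpoly"
  assumes "finite A" "\<And>v. v \<in> A \<Longrightarrow> l v = 1"
  shows "Poly_Mapping.lookup (Finite_Set.fold (\<lambda>v. partial v ^^ l v) p A) n =
    of_nat (\<Prod>v\<in>A. Poly_Mapping.lookup n v + 1) *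
    Poly_Mapping.lookup p (n + (\<Sum>v\<in>A. Poly_Mapping.single v 1))"
  using assms
proof (induction A arbitrary: n rule: finite_induct)
  case (insert x A)
  interpret comp_fun_commute "\<lambda>v. (partial v :: 'a mpoly \<Rightarrow> 'a mpoly) ^^ l v"
    by (rule comp_fun_commute_partial_pow)
  have eq: "(\<Prod>v\<in>A. Poly_Mapping.lookup (n + Poly_Mapping.single x 1) v + 1) =
      (\<Prod>v\<in>A. Poly_Mapping.lookup n v + 1)"
    using insert.hyps by (intro prod.cong) (auto simp: lookup_add lookup_single when_def)
  have "Poly_Mapping.lookup (Finite_Set.fold (\<lambda>v. partial v ^^ l v) p (insert x A)) n =
      of_nat (Poly_Mapping.lookup n x + 1) *
      Poly_Mapping.lookup (Finite_Set.fold (\<lambda>v. partial v ^^ l v) p A) (n + Poly_Mapping.single x 1)"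
    using insert by (simp add: lookup_partial)
  also have "\<dots> = of_nat (Poly_Mapping.lookup n x + 1) *
      (of_nat (\<Prod>v\<in>A. Poly_Mapping.lookup n v + 1) *
       Poly_Mapping.lookup p (n + Poly_Mapping.single x 1 + (\<Sum>v\<in>A. Poly_Mapping.single v 1)))"
    using insert.prems by (subst insert.IH) (simp_all only: eq insertI2)
  finally show ?case
    using insert.hyps by (simp only: prod.insert sum.insert of_nat_mult mult.assoc add.assoc
        not_False_eq_True)
qed simp

text \<open>The monomial at which the coefficient is read has no variable of a kind in
  \<open>S\<close>, so every factor from differentiation is 0 + 1. Hence the characteristic of the
  field is irrelevant.\<close>

lemma lookup_monom_op_mon:
  fixes p :: "'a::field mpoly"
  assumes "S \<subseteq> kinds"
  shows "Poly_Mapping.lookup (monom_op (mon S c) p) (mon (kinds - S) d) =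
    Poly_Mapping.lookup p (mon (kinds - S) d + mon S c)"
proof -
  have key: "kind v \<in> S" "Poly_Mapping.lookup (mon S c) v = 1"
    if "v \<in> Poly_Mapping.keys (mon S c)" for v
    using that by (auto simp: in_keys_iff lookup_mon[OF assms])
  have "(\<Prod>v\<in>Poly_Mapping.keys (mon S c). Poly_Mapping.lookup (mon (kinds - S) d) v + 1) = 1"
    by (rule prod.neutral) (use key in \<open>auto simp: lookup_mon\<close>)
  moreover have "(\<Sum>v\<in>Poly_Mapping.keys (mon S c). Poly_Mapping.single v 1) = mon S c"
    unfolding keys_mon[OF assms] by (simp add: sum.reindex[OF inj_on_mkvar[OF assms]] mon_def)
  ultimately show ?thesis
    unfolding monom_op_def by (subst lookup_fold_partial) (simp_all add: key)
qed

lemma lookup_scale: "Poly_Mapping.lookup (scale c p) n = c * Poly_Mapping.lookup p n"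
  unfolding scale_def mult_map_scale_conv_mult[symmetric] by (simp add: map.rep_eq when_def)

section \<open>The Hilbert function of a squarefree sum of monomials\<close>

text \<open>By \<open>surj\<close> each derivative has a monomial to be tested on, and by
  \<open>inj\<close> that monomial has a unique completion in \<open>T\<close>. The resulting
  coefficient matrix is the identity.\<close>

lemma H_eq_power_card:
  fixes T :: "(nat \<Rightarrow> nat) set"
  assumes S: "S \<subseteq> kinds" and T: "finite T"
    and surj: "\<And>c. c \<in> S \<rightarrow>\<^sub>E {1..k} \<Longrightarrow> \<exists>t\<in>T. \<forall>s\<in>S. t s = c s"
    and inj: "\<And>t t'. \<lbrakk>t \<in> T; t' \<in> T; \<forall>s\<in>kinds - S. t s = t' s\<rbrakk> \<Longrightarrow> t = t'"
  shows "H k (\<Sum>t\<in>T. Poly_Mapping.single (mon kinds t) 1 :: 'a::field mpoly) S = k ^ card S"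
proof -
  define f :: "'a mpoly" where "f = (\<Sum>t\<in>T. Poly_Mapping.single (mon kinds t) 1)"
  define I where "I = S \<rightarrow>\<^sub>E {1..k}"
  define D where "D = (\<lambda>c. monom_op (mon S c) f)"
  have finS: "finite S" using S by (rule finite_subset) simp
  have finI: "finite I" unfolding I_def by (rule finite_PiE) (use finS in auto)
  have cardI: "card I = k ^ card S" unfolding I_def using finS by (simp add: card_PiE)
  \<comment> \<open>\<open>\<tau> c\<close> is a chosen extension of \<open>c\<close> to a point of
    \<open>T\<close>; its part outside \<open>S\<close> is the test monomial for
    \<open>D c\<close>.\<close>
  obtain \<tau> where \<tau>: "\<And>c. c \<in> I \<Longrightarrow> \<tau> c \<in> T \<and> (\<forall>s\<in>S. \<tau> c s = c s)"
    using surj unfolding I_def by metis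
  have coeff: "Poly_Mapping.lookup (D c') (mon (kinds - S) (\<tau> c)) = of_bool (c' = c)"
    if c: "c \<in> I" and c': "c' \<in> I" for c c'
  proof -
    have eq: "mon kinds t = mon (kinds - S) (\<tau> c) + mon S c' \<longleftrightarrow> t = \<tau> c \<and> c' = c"
      if t: "t \<in> T" for t
    proof -
      have "mon kinds t = mon (kinds - S) (\<tau> c) + mon S c' \<longleftrightarrow>
          (\<forall>s\<in>S. t s = c' s) \<and> (\<forall>s\<in>kinds - S. t s = \<tau> c s)"
        unfolding mon_union[OF S] mon_eq_iff[OF subset_refl] using S by auto
      also have "(\<forall>s\<in>kinds - S. t s = \<tau> c s) \<longleftrightarrow> t = \<tau> c"
        using inj[OF t, of "\<tau> c"] \<tau>[OF c] by auto
      also have "(\<forall>s\<in>S. t s = c' s) \<and> t = \<tau> c \<longleftrightarrow> t = \<tau> c \<and> c' = c"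
      proof -
        have "(\<forall>s\<in>S. \<tau> c s = c' s) \<longleftrightarrow> c' = c"
          \<comment> \<open>Both functions are extensional, so agreement on \<open>S\<close> is
            equality.\<close>
          using \<tau>[OF c] c c' PiE_ext[of c' S "\<lambda>_. {1..k}" c] unfolding I_def by metis
        then show ?thesis by blast
      qed
      finally show ?thesis .
    qed
    have "Poly_Mapping.lookup (D c') (mon (kinds - S) (\<tau> c)) =
        (\<Sum>t\<in>T. 1 when mon kinds t = mon (kinds - S) (\<tau> c) + mon S c')"
      unfolding D_def lookup_monom_op_mon[OF S] unfolding f_def lookup_sum lookup_single ..
    also have "\<dots> = (\<Sum>t\<in>T. if t = \<tau> c then of_bool (c' = c) else 0)"
      by (rule sum.cong) (auto simp: eq when_def)
    also have "\<dots> = of_bool (c' = c)" using T \<tau>[OF c] by (simp add: sum.delta)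
    finally show ?thesis .
  qed
  have injD: "inj_on D I"
  proof (rule inj_onI)
    fix c c' assume "c \<in> I" "c' \<in> I" "D c = D c'"
    then have "of_bool (c = c) = (of_bool (c' = c) :: 'a)"
      using coeff[of c c] coeff[of c c'] by metis
    then show "c = c'" by (cases "c' = c") simp_all
  qed
  have "mpoly.independent (D ` I)"
  proof (rule mpoly.independent_if_scalars_zero)
    fix u x assume zero: "(\<Sum>x\<in>D ` I. scale (u x) x) = 0" and "x \<in> D ` I"
    then obtain c where c: "c \<in> I" "x = D c" by blast
    \<comment> \<open>Reading the coefficient at the test monomial of \<open>c\<close> leaves only
      the scalar of \<open>D c\<close>.\<close>
    have "0 = Poly_Mapping.lookup (\<Sum>c'\<in>I. scale (u (D c')) (D c')) (mon (kinds - S) (\<tau> c))"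
      using zero by (simp add: sum.reindex[OF injD])
    also have "\<dots> = (\<Sum>c'\<in>I. if c' = c then u (D c) else 0)"
      unfolding lookup_sum lookup_scale using c by (intro sum.cong) (auto simp: coeff)
    also have "\<dots> = u x" using c finI by (simp add: sum.delta)
    finally show "u x = 0" by simp
  qed (use finI in simp)
  moreover have "D ` I \<subseteq> {diff_op g f | g. g \<in> graded_component k (eS S)}"
  proof
    fix x assume "x \<in> D ` I"
    then obtain c where c: "c \<in> I" "x = D c" by blast
    let ?g = "Poly_Mapping.single (mon S c) (1::'a)"
    have "?g \<in> graded_component k (eS S)" "x = diff_op ?g f"
      using c unfolding graded_component_eS[OF S] diff_op_def I_def D_def by auto
    then show "x \<in> {diff_op g f | g. g \<in> graded_component k (eS S)}" by blast
  qed
  moreover have "{diff_op g f | g. g \<in> graded_component k (eS S)} \<subseteq> mpoly.span (D ` I)"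
    unfolding diff_op_def graded_component_eS[OF S] D_def I_def
    by clarify (rule mpoly.span_sum, rule mpoly.span_scale, rule mpoly.span_base, blast)
  moreover have "card (D ` I) = k ^ card S" using card_image[OF injD] cardI by simp
  ultimately show ?thesis
    unfolding H_def f_def[symmetric] by (intro mpoly.dim_unique)
qed

section \<open>The exponent configuration\<close>

lemma repr_mod_range: "k > 0 \<Longrightarrow> repr_mod k i \<in> {1..k}"
  unfolding repr_mod_eq using pos_mod_bound[of "int k" "i - 1"] by (auto simp: nat_less_iff Suc_le_eq)

lemma repr_mod_eq_iff:
  assumes "k > 0"
  shows "repr_mod k i = repr_mod k j \<longleftrightarrow> [i = j] (mod int k)"
proof -
  have "repr_mod k i = repr_mod k j \<longleftrightarrow> [i - 1 = j - 1] (mod int k)"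
    using assms by (simp add: repr_mod_eq cong_def eq_nat_nat_iff)
  then show ?thesis by (simp add: cong_iff_dvd_diff)
qed

lemma cong_imp_eq_range:
  assumes "i \<in> {1..k}" "j \<in> {1..k}" "[int i = int j] (mod int k)"
  shows "i = j"
proof -
  \<comment> \<open>The shift by one moves \<open>{1..k}\<close> to the residues 0 to
    \<open>k - 1\<close>, which \<open>mod\<close> fixes.\<close>
  have "[int i - 1 = int j - 1] (mod int k)" using assms(3) by (simp add: cong_iff_dvd_diff)
  then show ?thesis using assms(1,2) by (simp add: cong_def)
qed

definition point :: "nat \<Rightarrow> nat \<times> nat \<Rightarrow> nat \<Rightarrow> nat" where
  "point k ij s = (case ij of (i, j) \<Rightarrow>
    if s = 1 then i else if s = 2 then j
    else if s = 3 then repr_mod k (int j - int i) else repr_mod k (int i + int j))"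

lemma point_range:
  assumes "ij \<in> {1..k} \<times> {1..k}"
  shows "point k ij s \<in> {1..k}"
proof -
  have "k > 0" using assms by auto
  then show ?thesis using assms repr_mod_range[OF \<open>k > 0\<close>] by (auto simp: point_def simp del: atLeastAtMost_iff)
qed

text \<open>Modulo \<open>k\<close>, differences of coordinates are the linear forms x, y, y - x, x
  + y. Any two of them have determinant 1 or -1 up to the pair y - x, x + y, whose determinant is 2
  up to sign and so invertible for odd \<open>k\<close>.\<close>

lemma point_inj:
  assumes k: "odd k" and ab: "a \<in> kinds" "b \<in> kinds" "a \<noteq> b"
    and ij: "ij \<in> {1..k} \<times> {1..k}" and ij': "ij' \<in> {1..k} \<times> {1..k}"
    and eq: "point k ij a = point k ij' a" "point k ij b = point k ij' b"
  shows "ij = ij'"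
proof -
  obtain i j i' j' where p: "ij = (i, j)" "ij' = (i', j')" by (cases ij; cases ij')
  define x y where "x = int i - int i'" and "y = int j - int j'"
  have pos: "k > 0" using k by (rule odd_pos)
  have div: "(s = 1 \<and> int k dvd x) \<or> (s = 2 \<and> int k dvd y) \<or>
      (s = 3 \<and> int k dvd y - x) \<or> (s = 4 \<and> int k dvd x + y)"
    if "s \<in> kinds" "point k ij s = point k ij' s" for s
    using that by (auto simp: kinds_def p point_def repr_mod_eq_iff[OF pos] cong_iff_dvd_diff
        x_def y_def algebra_simps)
  have two: "int k dvd z" if "int k dvd 2 * z" for z
    using that k by (simp add: coprime_dvd_mult_right_iff)
  have sum_diff: "int k dvd x \<and> int k dvd y" if "int k dvd y - x" "int k dvd x + y"
  proof -
    have "int k dvd 2 * y" "int k dvd 2 * x"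
      using dvd_add[OF that] dvd_diff[OF that(2,1)] by (simp_all add: algebra_simps)
    then show ?thesis using two by blast
  qed
  have one: "int k dvd y" if "int k dvd x" "int k dvd y - x \<or> int k dvd x + y"
    using that dvd_add_left_iff[of "int k" x "y - x"] dvd_add_right_iff[of "int k" x y]
    unfolding diff_add_cancel by blast
  have other: "int k dvd x" if "int k dvd y" "int k dvd y - x \<or> int k dvd x + y"
    using that dvd_diff_right_iff[of "int k" y x] dvd_add_left_iff[of "int k" y x] by blast
  have "int k dvd x \<and> int k dvd y"
    using div[OF ab(1) eq(1)] div[OF ab(2) eq(2)] ab(3) sum_diff one other by metis
  then have "[int i = int i'] (mod int k)" "[int j = int j'] (mod int k)"
    by (simp_all add: cong_iff_dvd_diff x_def y_def)
  then have "i = i'" "j = j'"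
    using ij ij' unfolding p by (blast intro: cong_imp_eq_range)+
  then show ?thesis by (simp add: p)
qed

text \<open>Reading off two coordinates is an injective self-map of a finite square, hence
  onto.\<close>

lemma point_surj:
  assumes k: "odd k" and ab: "a \<in> kinds" "b \<in> kinds" "a \<noteq> b"
    and uv: "u \<in> {1..k}" "v \<in> {1..k}"
  shows "\<exists>ij\<in>{1..k} \<times> {1..k}. point k ij a = u \<and> point k ij b = v"
proof -
  let ?g = "\<lambda>ij. (point k ij a, point k ij b)"
  let ?G = "{1..k} \<times> {1..k}"
  have "?g ` ?G = ?G"
  proof (rule endo_inj_surj)
    show "?g ` ?G \<subseteq> ?G" using point_range by blast
    show "inj_on ?g ?G" by (rule inj_onI) (use point_inj[OF k ab] in blast)
  qed simp
  then have "(u, v) \<in> ?g ` ?G" using uv by blast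
  then show ?thesis by auto
qed

text \<open>Enlarging \<open>S\<close> to a pair treats the sizes 0, 1 and 2 at once.\<close>

lemma subset_kinds_pairE:
  assumes "S \<subseteq> kinds" "card S \<le> 2"
  obtains a b where "a \<in> kinds" "b \<in> kinds" "a \<noteq> b" "S \<subseteq> {a, b}"
proof -
  obtain P where P: "S \<subseteq> P" "P \<subseteq> kinds" "card P = 2"
    using exists_subset_between[of S 2 kinds] assms by auto
  then obtain a b where "P = {a, b}" "a \<noteq> b" by (auto simp: card_2_iff)
  with P show ?thesis by (intro that[of a b]) auto
qed

theorem theorem3p2:
  fixes k :: nat and f :: "'a::field mpoly"
  assumes "odd k"
    and "f = (\<Sum>i\<in>{1..k}. \<Sum>j\<in>{1..k}.
      Var (X i) * Var (Y j) * Var (Z (repr_mod k (int j - int i))) * Var (W (repr_mod k (int i + int j))))"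
  shows "balanced_neighborly k f"
proof -
  let ?G = "{1..k} \<times> {1..k}"
  define T where "T = point k ` ?G"
  \<comment> \<open>The first two coordinates already separate the points, so no terms merge when
    the double sum is reindexed over \<open>T\<close>.\<close>
  have "inj_on (point k) ?G"
    by (rule inj_onI) (use point_inj[OF assms(1), of 1 2] in \<open>auto simp: kinds_def\<close>)
  moreover have "f = (\<Sum>ij\<in>?G. Poly_Mapping.single (mon kinds (point k ij)) 1)"
    unfolding assms(2) sum.cartesian_product
    by (rule sum.cong)
      (auto simp: Var_def mult_single mon_def mkvar_def point_def kinds_def add.assoc)
  ultimately have f: "f = (\<Sum>t\<in>T. Poly_Mapping.single (mon kinds t) 1)"
    by (simp add: T_def sum.reindex)
  have "H k f S = k ^ card S" if S: "S \<subseteq> kinds" "card S \<le> 2" for S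
    unfolding f
  proof (rule H_eq_power_card[OF S(1)])
    fix c assume c: "c \<in> S \<rightarrow>\<^sub>E {1..k}"
    obtain a b where ab: "a \<in> kinds" "b \<in> kinds" "a \<noteq> b" "S \<subseteq> {a, b}"
      using subset_kinds_pairE[OF S] .
    \<comment> \<open>The value 1 is prescribed at \<open>a\<close> or \<open>b\<close> when that
      kind is not in \<open>S\<close>; any element of \<open>{1..k}\<close> would do.\<close>
    have "1 \<in> {1..k}" using odd_pos[OF assms(1)] by simp
    then have "(if s \<in> S then c s else 1) \<in> {1..k}" for s
      using c by (auto simp del: atLeastAtMost_iff)
    from point_surj[OF assms(1) ab(1-3) this this] obtain ij where
      "ij \<in> ?G" "point k ij a = (if a \<in> S then c a else 1)" "point k ij b = (if b \<in> S then c b else 1)"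
      by blast
    then show "\<exists>t\<in>T. \<forall>s\<in>S. t s = c s"
      using ab(4) by (intro bexI[of _ "point k ij"]) (auto simp: T_def)
  next
    fix t t' assume t: "t \<in> T" "t' \<in> T" and eq: "\<forall>s\<in>kinds - S. t s = t' s"
    \<comment> \<open>Here \<open>card S \<le> 2\<close> enters again: the complement keeps two
      coordinates, enough to determine the point.\<close>
    have "card (kinds - S) \<ge> 2"
      using S by (subst card_Diff_subset) (auto intro: finite_subset)
    then obtain P where "P \<subseteq> kinds - S" "card P = 2"
      using obtain_subset_with_card_n by metis
    then obtain a b where "a \<in> kinds - S" "b \<in> kinds - S" "a \<noteq> b"
      unfolding card_2_iff by auto
    moreover obtain ij ij' where "ij \<in> ?G" "t = point k ij" "ij' \<in> ?G" "t' = point k ij'"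
      using t unfolding T_def by blast
    ultimately show "t = t'" using eq point_inj[OF assms(1), of a b ij ij'] by blast
  qed (simp add: T_def)
  moreover have "f \<in> graded_component k (eS kinds)"
  proof -
    have "Poly_Mapping.keys f \<subseteq> mon kinds ` T"
      unfolding f using keys_sum[of "\<lambda>t. Poly_Mapping.single (mon kinds t) (1::'a)" T] by (auto simp: T_def)
    moreover have "mon kinds ` T \<subseteq> mon kinds ` (kinds \<rightarrow>\<^sub>E {1..k})"
    proof
      fix m assume "m \<in> mon kinds ` T"
      then obtain ij where ij: "ij \<in> ?G" "m = mon kinds (point k ij)" by (auto simp: T_def)
      \<comment> \<open>\<open>point k ij\<close> is not extensional, but \<open>mon kinds\<close>
        sees only its values on \<open>kinds\<close>.\<close>
      have "m = mon kinds (restrict (point k ij) kinds)"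
        unfolding ij(2) mon_eq_iff[OF subset_refl] by simp
      moreover have "restrict (point k ij) kinds \<in> kinds \<rightarrow>\<^sub>E {1..k}"
        using point_range[OF ij(1)] by (simp add: PiE_iff del: atLeastAtMost_iff)
      ultimately show "m \<in> mon kinds ` (kinds \<rightarrow>\<^sub>E {1..k})" by blast
    qed
    ultimately show ?thesis unfolding graded_component_eS[OF subset_refl] by blast
  qed
  moreover have "eS kinds = (1, 1, 1, 1)" by (simp add: eS_def e_def kinds_def)
  ultimately show ?thesis unfolding balanced_neighborly_def balanced_def kinds_def by simp
qed

end
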